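(* Let $(X,\preceq)$ be a partially ordered set (the relation $\preceq$ is reflexive, antisymmetric and transitive), let $x_0\in X$, and let $\eta:X\to\mathbb{R}\cup\{\pm\infty\}$ be an extended real-valued function which is monotone with respect to $\preceq$. For $x\in X$ write $S(x)=\{x'\in X: x'\preceq x\}$. Suppose that the following conditions are satisfied: (A) $-\infty<\inf\{\eta(x): x\in S(x_0)\}<+\infty$; (B) for any $x\in S(x_0)\setminus\{x_0\}$ with $-\infty<\eta(x)<+\infty$ and any $x'\in S(x)\setminus\{x\}$, one has $\eta(x)>\eta(x')$; (C) for any sequence $(x_n)_{n\ge 1}\subset S(x_0)$ with $x_n\in S(x_{n-1})\setminus\{x_{n-1}\}$ for all $n\geq 1$, and such that $\eta(x_n)-\inf\{\eta(x): x\in S(x_{n-1})\}\to 0$ as $n\to\infty$, there exists $u\in X$ such that $u\in S(x_n)$ for all $n$. Then there exists $\hat{x}\in X$ such that (a) $\hat{x}\in S(x_0)$; (b) $S(\hat{x})=\{\hat{x}\}$.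
   Context: A function $\eta:X\to\mathbb{R}\cup\{\pm\infty\}$ on a partially ordered set $(X,\preceq)$ is called monotone with respect to $\preceq$ if for any $x_1,x_2\in X$, $x_1\preceq x_2$ implies $\eta(x_1)\le\eta(x_2)$. In condition (C) the sequence $(x_n)_{n\ge1}$ starts from the given point $x_0$, so for $n=1$ the requirement reads $x_1\in S(x_0)\setminus\{x_0\}$. *)

theory Defs
  imports "HOL-Library.Extended_Real"
begin

text \<open>A pair \<open>(y, x) \<in> r\<close> is read as \<open>y \<preceq> x\<close>.\<close>

definition lower_section :: "'a set \<Rightarrow> 'a rel \<Rightarrow> 'a \<Rightarrow> 'a set" where
  "lower_section X r x = {y \<in> X. (y, x) \<in> r}"

text \<open>
  Differences of extended reals are taken in \<^typ>\<open>ereal\<close>, where \<open>\<infinity> - \<infinity> = \<infinity>\<close>. So a sequence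
  along which such (in ordinary notation undefined) differences occur infinitely often is not
  one whose differences tend to 0.
\<close>

end

theory Submission
  imports Defs
begin

text \<open>
  If no element of the section \<open>S(x\<^sub>0)\<close> were minimal, every \<open>x\<close> in it would have a predecessor
  other than \<open>x\<close> whose \<open>\<eta>\<close>-value is as close to \<open>inf \<eta>(S(x))\<close> as one likes
  (\<open>near_infimum_strict_predecessor\<close>). Taking the error at most \<open>1/n\<close> at the
  \<open>n\<close>-th step gives a strictly descending sequence as in (C), and hence a common lower bound \<open>u\<close>.
  Any predecessor \<open>v\<close> of \<open>u\<close> lies in all the sections \<open>S(x\<^sub>n)\<close>, so
  \<open>\<eta>(u) \<le> \<eta>(x\<^sub>n) \<le> inf \<eta>(S(x\<^sub>n\<^sub>-\<^sub>1)) + 1/n \<le> \<eta>(v) + 1/n\<close> for every \<open>n\<close>, and therefore \<open>\<eta>(u) \<le> \<eta>(v)\<close>.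
  Since \<open>u\<close> is not minimal, \<open>v\<close> can be chosen different from \<open>u\<close>, which contradicts (B).

  Some care is needed with infinite values. The value \<open>\<eta>(x\<^sub>0)\<close> may be \<open>\<infinity>\<close>, but (A) makes the
  infimum over \<open>S(x\<^sub>0)\<close> finite. A near-optimal \<open>x\<^sub>1\<close> has a finite value, so the infimum over \<open>S(x\<^sub>1)\<close>
  is finite again, and so on along the whole sequence.
\<close>

lemma lower_section_refl:
  assumes "partial_order_on X r" "x \<in> X"
  shows "x \<in> lower_section X r x"
  using assms by (auto simp: lower_section_def partial_order_on_def preorder_on_def refl_on_def)

lemma lower_section_trans:
  assumes "partial_order_on X r" "y \<in> lower_section X r x" "z \<in> lower_section X r y"
  shows "z \<in> lower_section X r x"
  using assms unfolding lower_section_def partial_order_on_def preorder_on_def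
  by (blast dest: transD)

lemma lower_section_antisym:
  assumes "partial_order_on X r" "y \<in> lower_section X r x" "x \<in> lower_section X r y"
  shows "x = y"
  using assms unfolding lower_section_def partial_order_on_def by (blast dest: antisymD)

lemma near_infimum_strict_predecessor:
  fixes \<eta> :: "'a \<Rightarrow> ereal" and \<epsilon> :: real
  assumes mono: "monotone_on X (\<lambda>x y. (x, y) \<in> r) (\<le>) \<eta>"
    and x: "x \<in> X"
    and fin: "\<bar>INF y\<in>lower_section X r x. \<eta> y\<bar> \<noteq> \<infinity>"
    and \<epsilon>: "\<epsilon> > 0"
    and nonmin: "y \<in> lower_section X r x - {x}"
  shows "\<exists>z\<in>lower_section X r x - {x}. \<eta> z < (INF y\<in>lower_section X r x. \<eta> y) + ereal \<epsilon>"
proof -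
  have "(INF y\<in>lower_section X r x. \<eta> y) < (INF y\<in>lower_section X r x. \<eta> y) + ereal \<epsilon>"
    using fin \<epsilon> by (cases "INF y\<in>lower_section X r x. \<eta> y") auto
  then obtain z where z: "z \<in> lower_section X r x"
      "\<eta> z < (INF y\<in>lower_section X r x. \<eta> y) + ereal \<epsilon>"
    by (auto simp: INF_less_iff)
  show ?thesis
  proof (cases "z = x")
    case True
    \<comment> \<open>If only \<open>x\<close> itself is known to be near-optimal, monotonicity makes any \<open>y\<close> below it at
      least as good.\<close>
    have "\<eta> y \<le> \<eta> x"
      using nonmin x by (intro monotone_onD[OF mono]) (auto simp: lower_section_def)
    then show ?thesis using nonmin z True by (auto intro: le_less_trans)
  qed (use z in auto)
qed

theorem theorem2p1:
  fixes X :: "'a set" and r :: "'a rel" and x0 :: 'a and \<eta> :: "'a \<Rightarrow> ereal"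
  assumes order: "partial_order_on X r"
    and x0: "x0 \<in> X"
    and mono: "monotone_on X (\<lambda>x y. (x, y) \<in> r) (\<le>) \<eta>"
    and A: "- \<infinity> < (INF x\<in>lower_section X r x0. \<eta> x)"
           "(INF x\<in>lower_section X r x0. \<eta> x) < \<infinity>"
    and B: "\<And>x x'. x \<in> lower_section X r x0 - {x0} \<Longrightarrow> - \<infinity> < \<eta> x \<Longrightarrow> \<eta> x < \<infinity> \<Longrightarrow>
              x' \<in> lower_section X r x - {x} \<Longrightarrow> \<eta> x > \<eta> x'"
    and C: "\<And>x :: nat \<Rightarrow> 'a.
              x 0 = x0 \<Longrightarrow>
              (\<forall>n\<ge>1. x n \<in> lower_section X r x0) \<Longrightarrow>
              (\<forall>n\<ge>1. x n \<in> lower_section X r (x (n - 1)) - {x (n - 1)}) \<Longrightarrow>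
              (\<lambda>n. \<eta> (x n) - (INF y\<in>lower_section X r (x (n - 1)). \<eta> y)) \<longlonglongrightarrow> 0 \<Longrightarrow>
              \<exists>u\<in>X. \<forall>n\<ge>1. u \<in> lower_section X r (x n)"
  shows "\<exists>xhat\<in>X. xhat \<in> lower_section X r x0 \<and> lower_section X r xhat = {xhat}"
proof (rule ccontr)
  let ?S = "lower_section X r"
  define I where "I x = (INF y\<in>?S x. \<eta> y)" for x
  note trans = lower_section_trans[OF order]
  assume no_min: "\<not> ?thesis"
  have nonmin: "\<exists>y. y \<in> ?S x - {x}" if "x \<in> ?S x0" for x
  proof -
    have "x \<in> X" using that by (simp add: lower_section_def)
    then show ?thesis using no_min that lower_section_refl[OF order] by blast
  qed
  have I_lower: "I x \<le> \<eta> y" if "y \<in> ?S x" for x y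
    unfolding I_def using that by (rule INF_lower)
  have I_gt: "- \<infinity> < I x" if "x \<in> ?S x0" for x
  proof -
    have "I x0 \<le> I x" unfolding I_def using trans[OF that] by (intro INF_superset_mono) auto
    then show ?thesis using A(1) unfolding I_def[symmetric] by (rule less_le_trans[rotated])
  qed

  \<comment> \<open>Finiteness of the infimum over the section is the invariant that lets the choice of
    near-optimal predecessors go on.\<close>
  have "\<exists>x. \<forall>n. (x n \<in> ?S x0 \<and> I (x n) < \<infinity> \<and> (n = 0 \<longrightarrow> x n = x0)) \<and>
      (x (Suc n) \<in> ?S (x n) - {x n} \<and> \<eta> (x (Suc n)) < I (x n) + ereal (1 / real (Suc n)))"
  proof (rule dependent_nat_choice)
    show "\<exists>x. x \<in> ?S x0 \<and> I x < \<infinity> \<and> ((0::nat) = 0 \<longrightarrow> x = x0)"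
      using A(2) lower_section_refl[OF order x0] by (auto simp: I_def)
  next
    fix x and n :: nat
    assume x: "x \<in> ?S x0 \<and> I x < \<infinity> \<and> (n = 0 \<longrightarrow> x = x0)"
    have xX: "x \<in> X" using x by (simp add: lower_section_def)
    have fin: "\<bar>I x\<bar> \<noteq> \<infinity>" using x I_gt[of x] by auto
    obtain y where "y \<in> ?S x - {x}" using nonmin x by blast
    from near_infimum_strict_predecessor[OF mono xX fin[unfolded I_def] _ this, of "1 / real (Suc n)"]
    obtain z where z: "z \<in> ?S x - {x}" "\<eta> z < I x + ereal (1 / real (Suc n))"
      by (auto simp: I_def)
    have "z \<in> X" using z(1) by (simp add: lower_section_def)
    then have "I z \<le> \<eta> z" by (intro I_lower lower_section_refl[OF order])
    then have "I z < \<infinity>" using z(2) fin by (cases "I x") auto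
    moreover have "z \<in> ?S x0" using trans x z by blast
    ultimately show "\<exists>z. (z \<in> ?S x0 \<and> I z < \<infinity> \<and> (Suc n = 0 \<longrightarrow> z = x0)) \<and>
        (z \<in> ?S x - {x} \<and> \<eta> z < I x + ereal (1 / real (Suc n)))"
      using z by blast
  qed
  then obtain x where x_sec: "\<And>n. x n \<in> ?S x0" and x_fin: "\<And>n. I (x n) < \<infinity>"
    and x_0: "x 0 = x0" and x_step: "\<And>n. x (Suc n) \<in> ?S (x n) - {x n}"
    and x_near: "\<And>n. \<eta> (x (Suc n)) < I (x n) + ereal (1 / real (Suc n))"
    by blast

  have gap: "0 \<le> \<eta> (x (Suc n)) - I (x n) \<and> \<eta> (x (Suc n)) - I (x n) \<le> ereal (1 / real (Suc n))" for n
  proof -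
    have "I (x n) \<le> \<eta> (x (Suc n))" using x_step by (intro I_lower) auto
    then show ?thesis using x_near[of n] x_fin[of n] I_gt[OF x_sec[of n]]
      by (cases "I (x n)"; cases "\<eta> (x (Suc n))") auto
  qed
  have eps: "(\<lambda>n. ereal (1 / real (Suc n))) \<longlonglongrightarrow> 0"
    unfolding zero_ereal_def
    using LIMSEQ_inverse_real_of_nat by (intro tendsto_ereal) (simp add: inverse_eq_divide)
  have "(\<lambda>n. \<eta> (x (Suc n)) - I (x n)) \<longlonglongrightarrow> 0"
    using gap by (intro tendsto_sandwich[OF _ _ tendsto_const eps]) auto
  then have lim: "(\<lambda>n. \<eta> (x n) - I (x (n - 1))) \<longlonglongrightarrow> 0"
    by (subst filterlim_sequentially_Suc[symmetric]) simp
  have "\<exists>u\<in>X. \<forall>n\<ge>1. u \<in> ?S (x n)"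
  proof (rule C)
    show "\<forall>n\<ge>1. x n \<in> ?S (x (n - 1)) - {x (n - 1)}"
      using x_step by (metis One_nat_def Suc_le_D diff_Suc_1)
  qed (use x_0 x_sec lim in \<open>auto simp: I_def\<close>)
  then obtain u where "\<forall>n\<ge>1. u \<in> ?S (x n)" by blast
  then have u: "u \<in> ?S (x (Suc n))" for n by simp
  have u0: "u \<in> ?S x0" using trans[OF x_sec u] .
  \<comment> \<open>Condition (B) says nothing about \<open>x0\<close>, but \<open>u\<close> lies below \<open>x 1\<close>, which differs from \<open>x0\<close>.\<close>
  have u_neq: "u \<noteq> x0"
    using lower_section_antisym[OF order x_sec, of "Suc 0"] u[of 0] x_step[of 0] x_0 by auto
  obtain v where v: "v \<in> ?S u - {u}" using nonmin[OF u0] by blast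
  have near: "\<eta> u < I (x n) + ereal (1 / real (Suc n))" for n
  proof -
    have "\<eta> u \<le> \<eta> (x (Suc n))"
      using u[of n] x_sec[of "Suc n"]
      by (intro monotone_onD[OF mono]) (auto simp: lower_section_def)
    then show ?thesis using x_near[of n] by (rule le_less_trans)
  qed
  have "\<eta> u \<le> \<eta> v + ereal (1 / real (Suc n))" for n
  proof -
    have "v \<in> ?S (x n)" using v u[of n] x_step[of n] trans by blast
    then have "I (x n) + ereal (1 / real (Suc n)) \<le> \<eta> v + ereal (1 / real (Suc n))"
      by (intro add_right_mono I_lower)
    then show ?thesis using near[of n] by order
  qed
  moreover have "\<eta> v \<noteq> - \<infinity>"
    using I_gt[OF u0] I_lower[of v u] v by auto
  then have "(\<lambda>n. \<eta> v + ereal (1 / real (Suc n))) \<longlonglongrightarrow> \<eta> v + 0"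
    using eps by (intro tendsto_add_ereal_nonneg) auto
  ultimately have "\<eta> u \<le> \<eta> v"
    by (intro LIMSEQ_le_const[of _ "\<eta> v"]) auto
  moreover have "\<eta> v < \<eta> u"
  proof (rule B)
    show "u \<in> ?S x0 - {x0}" using u0 u_neq by simp
    have "u \<in> X" using u0 by (simp add: lower_section_def)
    then have "I u \<le> \<eta> u" by (intro I_lower lower_section_refl[OF order])
    then show "- \<infinity> < \<eta> u" using I_gt[OF u0] by order
    show "\<eta> u < \<infinity>" using near[of 0] x_fin[of 0] by (cases "I (x 0)"; cases "\<eta> u") auto
  qed (use v in auto)
  ultimately show False by order
qed

end
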